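(* Let $n,m,J\ge 1$ be integers, let $\mathbf{Z}\in\mathbb{R}^{n\times m}$, let $\mathbf{u}_1,\dots,\mathbf{u}_J\in\mathbb{R}^{1\times n}$ and $\mathbf{v}_1,\dots,\mathbf{v}_J\in\mathbb{R}^{1\times m}$ be unit-norm row vectors satisfying the zero-forcing condition $\mathbf{u}_l\mathbf{Z}\mathbf{v}_k^{T}=0$ for all $l\neq k$, and let $\mathcal{P}_1,\dots,\mathcal{P}_J\ge 0$ be stream powers with $\sum_{l}\mathcal{P}_l=\mathcal{P}$. Let System 1 (the original system) have channel matrix $\mathbf{Z}$, transmit filters $\mathbf{u}_l$, receive filters $\mathbf{v}_l$ and powers $\mathcal{P}_l$. Let System 2 be its dual system, with channel matrix $\mathbf{F}=\mathbf{Z}^{T}$, transmit filters $\mathbf{v}_l$, receive filters $\mathbf{u}_l$ and the same powers $\mathcal{P}_l$. Then for every $k\in\{1,\dots,J\}$ the two systems have the same SNR at the output of the $k$th receive filter: $$\mathrm{SNR}_{\mathrm{orig},k}=\mathrm{SNR}_{\mathrm{dual},k}.$$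
   Context: All quantities are real, and $\|\cdot\|$ is the Euclidean norm (absolute value for scalars). Unit-power information streams $c_1,\dots,c_J$ are transmitted simultaneously. System 1: the input is $\mathbf{s}=\sum_{l=1}^J\sqrt{\mathcal{P}_l}\,\mathbf{u}_l c_l\in\mathbb{R}^{1\times n}$, and the output is $\mathbf{d}=\mathbf{s}\mathbf{Z}+\mathbf{n}\in\mathbb{R}^{1\times m}$, where $\mathbf{n}$ has i.i.d. $\mathcal{N}(0,1)$ entries. To extract $c_k$ the receiver computes $\hat y_k=\mathbf{d}\mathbf{v}_k^{T}$. Under the zero-forcing condition this equals $\sqrt{\mathcal{P}_k}\,c_k\,\mathbf{u}_k\mathbf{Z}\mathbf{v}_k^{T}+\mathbf{n}\mathbf{v}_k^{T}$, and its SNR is $$\mathrm{SNR}_{\mathrm{orig},k}=\mathcal{P}_k\|\mathbf{u}_k\mathbf{Z}\mathbf{v}_k^{T}\|^2 .$$ System 2: the input is $\mathbf{x}=\sum_{l=1}^J\sqrt{\mathcal{P}_l}\,\mathbf{v}_l c_l\in\mathbb{R}^{1\times m}$, and the output is $\mathbf{r}=\mathbf{x}\mathbf{F}+\mathbf{w}\in\mathbb{R}^{1\times n}$, where $\mathbf{w}$ has i.i.d. $\mathcal{N}(0,1)$ entries. To extract $c_k$ the receiver computes $\hat r_k=\mathbf{r}\mathbf{u}_k^{T}$, treating the interfering streams as noise, so that the output SNR is $$\mathrm{SNR}_{\mathrm{dual},k}=\frac{\mathcal{P}_k\|\mathbf{v}_k\mathbf{F}\mathbf{u}_k^{T}\|^2}{\sum_{l\neq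 k}\mathcal{P}_l\|\mathbf{v}_l\mathbf{F}\mathbf{u}_k^{T}\|^2+1}.$$ *)

theory Defs
  imports "HOL-Analysis.Analysis"
begin

(*
  Index types: 'i inputs of the channel, 'o outputs, 'j streams (all finite and nonempty).
  Row vectors are elements of real ^ 'i and real ^ 'o, so that x H is "x v* H" and the scalar
  d g^T is the inner product of d and g.  Every system is given by its channel matrix H, transmit
  filters t, receive filters g and stream powers p.
*)

definition channel_input :: "('j::finite \<Rightarrow> real ^ 'i) \<Rightarrow> ('j \<Rightarrow> real) \<Rightarrow> ('j \<Rightarrow> real) \<Rightarrow> real ^ 'i" where
  "channel_input t p c = (\<Sum>l\<in>UNIV. (sqrt (p l) * c l) *\<^sub>R t l)"

definition channel_output :: "real ^ 'o ^ 'i \<Rightarrow> real ^ 'i \<Rightarrow> real ^ 'o \<Rightarrow> real ^ 'o" where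
  "channel_output H x w = x v* H + w"

definition filter_output ::
  "real ^ 'o ^ 'i \<Rightarrow> ('j::finite \<Rightarrow> real ^ 'i) \<Rightarrow> ('j \<Rightarrow> real ^ 'o) \<Rightarrow> ('j \<Rightarrow> real)
    \<Rightarrow> ('j \<Rightarrow> real) \<Rightarrow> real ^ 'o \<Rightarrow> 'j \<Rightarrow> real" where
  "filter_output H t g p c w k = channel_output H (channel_input t p c) w \<bullet> g k"

definition zero_forcing ::
  "real ^ 'o ^ 'i \<Rightarrow> ('j \<Rightarrow> real ^ 'i) \<Rightarrow> ('j \<Rightarrow> real ^ 'o) \<Rightarrow> bool" where
  "zero_forcing H t g \<longleftrightarrow> (\<forall>l k. l \<noteq> k \<longrightarrow> (t l v* H) \<bullet> g k = 0)"

(*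
  SNRs at the output of the k-th receive filter for unit-power streams and i.i.d. N(0,1) noise w.
  The receive filters are meant to have unit norm, so the filtered noise has variance 1: this is
  the noise term 1 in snr_interference and the omitted denominator of snr_zf.  The formula snr_zf
  is the SNR of a system under zero_forcing (no interference is left in filter_output, see the
  lemma filter_output_zero_forcing below); snr_interference treats the other streams as noise.
*)

definition snr_zf ::
  "real ^ 'o ^ 'i \<Rightarrow> ('j \<Rightarrow> real ^ 'i) \<Rightarrow> ('j \<Rightarrow> real ^ 'o) \<Rightarrow> ('j \<Rightarrow> real) \<Rightarrow> 'j \<Rightarrow> real" where
  "snr_zf H t g p k = p k * (norm ((t k v* H) \<bullet> g k))\<^sup>2"

definition snr_interference ::
  "real ^ 'o ^ 'i \<Rightarrow> ('j::finite \<Rightarrow> real ^ 'i) \<Rightarrow> ('j \<Rightarrow> real ^ 'o) \<Rightarrow> ('j \<Rightarrow> real) \<Rightarrow> 'j \<Rightarrow> real" where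
  "snr_interference H t g p k =
     p k * (norm ((t k v* H) \<bullet> g k))\<^sup>2 /
     ((\<Sum>l\<in>UNIV - {k}. p l * (norm ((t l v* H) \<bullet> g k))\<^sup>2) + 1)"

lemma filter_output_expand:
  "filter_output H t g p c w k =
     sqrt (p k) * c k * ((t k v* H) \<bullet> g k)
     + (\<Sum>l\<in>UNIV - {k}. sqrt (p l) * c l * ((t l v* H) \<bullet> g k)) + w \<bullet> g k"
proof -
  have "filter_output H t g p c w k =
      (\<Sum>l\<in>UNIV. sqrt (p l) * c l * ((t l v* H) \<bullet> g k)) + w \<bullet> g k"
    unfolding filter_output_def channel_output_def channel_input_def
    by (simp add: inner_add_left dot_lmul_matrix inner_sum_left)
  then show ?thesis
    by (simp add: sum.remove[of UNIV k])
qed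

lemma filter_output_zero_forcing:
  assumes "zero_forcing H t g"
  shows "filter_output H t g p c w k = sqrt (p k) * c k * ((t k v* H) \<bullet> g k) + w \<bullet> g k"
  unfolding filter_output_expand using assms by (auto simp: zero_forcing_def intro!: sum.neutral)

end

theory Submission
  imports Defs
begin

text \<open>A scalar equals its transpose, so the dual gain from stream l to filter k is the
  original gain from stream k to filter l (\<open>vector_matrix_transpose_inner\<close>). For l = k
  the signal powers agree; for l distinct from k, zero forcing removes the dual interference too,
  leaving only unit noise.\<close>

lemma vector_matrix_transpose_inner:
  fixes A :: "real ^ 'm ^ 'n"
  shows "(y v* transpose A) \<bullet> x = (x v* A) \<bullet> y"
  by (metis dot_lmul_matrix inner_commute vector_transpose_matrix)

theorem proposition1:
  fixes Z :: "real ^ 'm ^ 'n"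
    and u :: "'j::finite \<Rightarrow> real ^ 'n"
    and v :: "'j \<Rightarrow> real ^ 'm"
    and p :: "'j \<Rightarrow> real"
    and P :: real
  assumes "\<And>l. norm (u l) = 1"
    and "\<And>l. norm (v l) = 1"
    and "zero_forcing Z u v"
    and "\<And>l. 0 \<le> p l"
    and "(\<Sum>l\<in>UNIV. p l) = P"
  shows "\<forall>k. snr_zf Z u v p k = snr_interference (transpose Z) v u p k"
proof
  fix k
  \<comment> \<open>After transposing, each summand contains
    \<open>(u k v* Z) \<bullet> v l\<close>: zero forcing applies with the roles of \<open>k\<close>
    and \<open>l\<close> exchanged.\<close>
  have "(\<Sum>l\<in>UNIV - {k}. p l * (norm ((v l v* transpose Z) \<bullet> u k))\<^sup>2) = 0"
    unfolding vector_matrix_transpose_inner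
    using assms(3) by (intro sum.neutral) (auto simp: zero_forcing_def)
  then show "snr_zf Z u v p k = snr_interference (transpose Z) v u p k"
    unfolding snr_zf_def snr_interference_def
    by (simp only: vector_matrix_transpose_inner) simp
qed

end
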